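(* Let $F$ be a field of characteristic $2$, let $n\geq 3$, and let $X$ be the set of all involutions in $\mathrm{GL}_n(F)$. Then $\operatorname{Diam}\Gamma(\mathrm{GL}_n(F),X)=3$.
   Context: An involution is an element of order $2$. For a subset $X$ of a group $G$, the commuting graph $\Gamma(G,X)$ has vertex set $X$, and distinct $x,y\in X$ are joined by an edge iff $xy=yx$. The distance between two vertices is the number of edges in a shortest path connecting them, and the diameter $\operatorname{Diam}\Gamma(G,X)$ of a connected graph is the maximum distance over all pairs of vertices. *)

theory Defs
  imports
    "Jordan_Normal_Form.Matrix"
    "Graph_Theory.Graph_Theory"
    "HOL-Algebra.Multiplicative_Group"
begin

definition GL :: "'a :: field itself \<Rightarrow> nat \<Rightarrow> 'a mat monoid" where
  "GL ty n = units_of (ring_mat ty n ())"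

definition involutions :: "('a, 'b) monoid_scheme \<Rightarrow> 'a set" where
  "involutions G = {x \<in> carrier G. group.ord G x = 2}"

text \<open>Undirected graphs are represented, as usual in \<^theory>\<open>Graph_Theory.Digraph\<close>, by symmetric
  digraphs.\<close>

definition commuting_graph :: "('a, 'b) monoid_scheme \<Rightarrow> 'a set \<Rightarrow> 'a pair_pre_digraph" where
  "commuting_graph G X =
     \<lparr>pverts = X,
      parcs = {(x, y). x \<in> X \<and> y \<in> X \<and> x \<noteq> y \<and> x \<otimes>\<^bsub>G\<^esub> y = y \<otimes>\<^bsub>G\<^esub> x}\<rparr>"

text \<open>With unit weights, the library's shortest-path cost counts edges; it is \<open>\<infinity>\<close> if there is
  no walk.\<close>

definition graph_dist :: "('a, 'b) pre_digraph \<Rightarrow> 'a \<Rightarrow> 'a \<Rightarrow> ereal" where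
  "graph_dist G u v = wf_digraph.\<mu> G (\<lambda>_. 1) u v"

text \<open>The distances are natural numbers or \<open>\<infinity>\<close>, so a finite supremum over a nonempty vertex set
  is attained, i.e. it is the maximum distance.\<close>

definition graph_diameter :: "('a, 'b) pre_digraph \<Rightarrow> ereal" where
  "graph_diameter G = (SUP (u, v) \<in> verts G \<times> verts G. graph_dist G u v)"

text \<open>The locale constants \<^const>\<open>group.ord\<close> and \<^const>\<open>wf_digraph.\<mu>\<close> are specified only
  for groups and well-formed digraphs, respectively; the next two lemmas discharge this.\<close>

lemma group_GL: "group (GL ty n)"
proof -
  have "monoid (ring_mat ty n ())"
    using semiring_mat[of n "()", where 'a = 'a] unfolding semiring_def ring_mat_def by simp
  then show ?thesis
    unfolding GL_def by (rule monoid.units_group)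
qed

lemma sym_digraph_commuting_graph: "sym_digraph (with_proj (commuting_graph G X))"
  by unfold_locales
    (auto simp: commuting_graph_def with_proj_def symmetric_def sym_def arcs_ends_def
      arc_to_ends_def)

end

theory Submission
  imports Defs "Jordan_Normal_Form.Determinant"
begin

text \<open>In characteristic 2 the involutions are the matrices \<open>1 + A\<close> with \<open>A\<^sup>2 = 0 \<noteq> A\<close>, and
  commutation of involutions is commutation of these square-zero parts.

  Upper bound: given \<open>A\<close> and \<open>B\<close>, choose nonzero \<open>u\<close> in the image of \<open>A\<close> and \<open>v\<close> in the
  image of \<open>B\<close>. Since \<open>A\<close> has rank at most \<open>n/2 < n - 1\<close>, some nonzero functional \<open>f\<close>
  vanishes on the image of \<open>A\<close> and on \<open>v\<close>; likewise some \<open>g\<close> vanishes on the image of \<open>B\<close>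
  and on \<open>u\<close>. Then \<open>A\<close>, \<open>u f\<^sup>T\<close>, \<open>v g\<^sup>T\<close>, \<open>B\<close> commute consecutively.

  Lower bound: with \<open>m = \<lfloor>n/2\<rfloor>\<close>, let \<open>A\<close> and \<open>B\<close> have the \<open>m \<times> m\<close> identity as upper right
  block and an invertible companion matrix \<open>N\<close> of a squarefree polynomial as lower left block,
  respectively, padded by a zero row and column for odd \<open>n\<close>. The common centralizer of \<open>A\<close>
  and \<open>B\<close> is the centralizer of \<open>N\<close>, times the base field for odd \<open>n\<close>, so it has no nonzero
  nilpotent elements.\<close>

subsection \<open>Square-zero matrices at distance at most three\<close>

text \<open>As \<open>n\<close> is at least 3, \<open>v\<close>, \<open>w\<close> and a zero row all
  fit among the rows of one square matrix; it is singular, and a kernel vector is orthogonal to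
  both.\<close>

lemma common_orthogonal_vec:
  fixes v w :: "'a :: field vec"
  assumes n: "n \<ge> 3" and v: "v \<in> carrier_vec n" and w: "w \<in> carrier_vec n"
  obtains f where "f \<in> carrier_vec n" "f \<noteq> 0\<^sub>v n" "v \<bullet> f = 0" "w \<bullet> f = 0"
proof -
  define r where "r i = (if i = 0 then v else w)" for i :: nat
  define M where "M = mat\<^sub>r n n (\<lambda>i. if i = 2 then 0\<^sub>v n else r i)"
  have M: "M \<in> carrier_mat n n"
    by (simp add: M_def)
  have "det M = 0"
    unfolding M_def using n v w by (intro det_row_0) (auto simp: r_def)
  then obtain f where f: "f \<in> carrier_vec n" "f \<noteq> 0\<^sub>v n" "M *\<^sub>v f = 0\<^sub>v n"
    using det_0_iff_vec_prod_zero[OF M] by blast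
  have "row M i \<bullet> f = 0" if "i < n" for i
    using f(3) that M by (metis carrier_matD(1) index_mult_mat_vec index_zero_vec(1))
  from this[of 0] this[of 1] have "v \<bullet> f = 0" "w \<bullet> f = 0"
    using n v w by (simp_all add: M_def r_def)
  with f that show ?thesis by blast
qed

text \<open>Nonzero, so that \<open>1 + A\<close> is not the identity.\<close>

definition square_zero :: "nat \<Rightarrow> 'a :: semiring_1 mat \<Rightarrow> bool" where
  "square_zero n A \<longleftrightarrow> A \<in> carrier_mat n n \<and> A * A = 0\<^sub>m n n \<and> A \<noteq> 0\<^sub>m n n"

lemma transpose_mult_row:
  fixes A B :: "'a :: comm_semiring_0 mat"
  assumes "A \<in> carrier_mat n n" "B \<in> carrier_mat n n" "i < n"
  shows "transpose_mat B *\<^sub>v row A i = row (A * B) i"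
  using assms by (intro eq_vecI) (auto simp: scalar_prod_def mult.commute intro!: sum.cong)

text \<open>No notion of rank enters. The rows of \<open>A\<close> lie in its left kernel because
  \<open>A * A = 0\<close>, so a nonzero combination of rows orthogonal to \<open>v\<close>
  suffices. If no combination of two rows works, \<open>A\<close> has rank one and \<open>f\<close>
  is chosen orthogonal to its image directly.\<close>

lemma square_zero_left_kernel:
  fixes A :: "'a :: field mat"
  assumes n: "n \<ge> 3" and A: "square_zero n A" and v: "v \<in> carrier_vec n"
  obtains f where "f \<in> carrier_vec n" "f \<noteq> 0\<^sub>v n" "transpose_mat A *\<^sub>v f = 0\<^sub>v n" "v \<bullet> f = 0"
proof -
  have cA [simp]: "A \<in> carrier_mat n n" "dim_row A = n" "dim_col A = n"
    and AA: "A * A = 0\<^sub>m n n" and nz: "A \<noteq> 0\<^sub>m n n"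
    using A by (auto simp: square_zero_def)
  have dv [simp]: "dim_vec v = n" using v by simp
  define p where "p i = row A i" for i
  have p [simp]: "p i \<in> carrier_vec n" "dim_vec (p i) = n" for i
    using row_carrier[of A i] by (simp_all add: p_def)
  have ker: "transpose_mat A *\<^sub>v p i = 0\<^sub>v n" if "i < n" for i
    unfolding p_def transpose_mult_row[OF cA(1) cA(1) that] AA using that by simp
  define s where "s i = v \<bullet> p i" for i
  have "\<exists>i<n. p i \<noteq> 0\<^sub>v n"
  proof (rule ccontr)
    assume "\<not> ?thesis"
    then have "A = 0\<^sub>m n n"
      by (intro eq_rowI) (auto simp: p_def)
    with nz show False by simp
  qed
  then obtain i0 where i0: "i0 < n" "p i0 \<noteq> 0\<^sub>v n" by blast
  show ?thesis
  proof (cases "\<forall>i<n. s i = 0")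
    case True
    with i0 ker show ?thesis by (intro that[of "p i0"]) (auto simp: s_def)
  next
    case False
    then obtain j where j: "j < n" "s j \<noteq> 0" by blast
    show ?thesis
    proof (cases "\<forall>i<n. s j \<cdot>\<^sub>v p i = s i \<cdot>\<^sub>v p j")
      \<comment> \<open>All rows are multiples of \<open>p j\<close>: \<open>s j\<close> times
        \<open>A\<close> is the outer product of \<open>A v\<close> and \<open>p j\<close>. Hence
        orthogonality to \<open>A v\<close> puts \<open>f\<close> in the left kernel, and only two
        linear conditions on \<open>f\<close> remain.\<close>
      case True
      have Av: "A *\<^sub>v v \<in> carrier_vec n" using v by (rule mult_mat_vec_carrier[OF cA(1)])
      obtain f where f: "f \<in> carrier_vec n" "f \<noteq> 0\<^sub>v n" "(A *\<^sub>v v) \<bullet> f = 0" "v \<bullet> f = 0"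
        using common_orthogonal_vec[OF n Av v] .
      have [simp]: "dim_vec f = n" using f by simp
      have si: "(A *\<^sub>v v) $ i = s i" if "i < n" for i
        using that v by (simp add: s_def p_def comm_scalar_prod[of v n])
      have "s j * (transpose_mat A *\<^sub>v f) $ k = 0" if k: "k < n" for k
      proof -
        have "s j * (transpose_mat A *\<^sub>v f) $ k = (\<Sum>i\<in>{0..<n}. (s j \<cdot>\<^sub>v p i) $ k * f $ i)"
          using k by (simp add: scalar_prod_def p_def sum_distrib_left mult.assoc)
        also have "\<dots> = (\<Sum>i\<in>{0..<n}. ((A *\<^sub>v v) $ i * f $ i) * p j $ k)"
          using k True si by (intro sum.cong) (auto simp: mult_ac simp del: index_mult_mat_vec)
        also have "\<dots> = ((A *\<^sub>v v) \<bullet> f) * p j $ k"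
          by (simp add: scalar_prod_def sum_distrib_right)
        finally show ?thesis using f by simp
      qed
      then have "transpose_mat A *\<^sub>v f = 0\<^sub>v n"
        using j by (intro eq_vecI) (auto simp del: index_mult_mat_vec)
      with f that show ?thesis by blast
    next
      case False
      then obtain i where i: "i < n" "s j \<cdot>\<^sub>v p i \<noteq> s i \<cdot>\<^sub>v p j" by blast
      \<comment> \<open>The coefficients are chosen so that the two contributions to
        \<open>v \<bullet> f\<close> cancel.\<close>
      define f where "f = s j \<cdot>\<^sub>v p i - s i \<cdot>\<^sub>v p j"
      have f: "f \<in> carrier_vec n" by (simp add: f_def)
      have "f \<noteq> 0\<^sub>v n"
      proof
        assume "f = 0\<^sub>v n"
        then have "(s j \<cdot>\<^sub>v p i - s i \<cdot>\<^sub>v p j) $ k = 0" if "k < n" for k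
          using that by (simp add: f_def)
        then have "s j \<cdot>\<^sub>v p i = s i \<cdot>\<^sub>v p j"
          by (intro eq_vecI) auto
        with i show False by simp
      qed
      moreover have "transpose_mat A *\<^sub>v f = 0\<^sub>v n"
        unfolding f_def using ker i j
        by (subst mult_minus_distrib_mat_vec[of _ n n]) (auto simp: mult_mat_vec[of _ n n])
      moreover have "v \<bullet> f = 0"
        unfolding f_def using v
        by (subst scalar_prod_minus_distrib[of _ n]) (auto simp: s_def)
      ultimately show ?thesis using f that by blast
    qed
  qed
qed

section \<open>Rank-one matrices as connecting vertices\<close>

definition outer_prod :: "'a :: semiring_0 vec \<Rightarrow> 'a vec \<Rightarrow> 'a mat" where
  "outer_prod u f = mat (dim_vec u) (dim_vec f) (\<lambda>(i, j). u $ i * f $ j)"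

lemma outer_prod_carrier [simp]:
  "u \<in> carrier_vec n \<Longrightarrow> f \<in> carrier_vec m \<Longrightarrow> outer_prod u f \<in> carrier_mat n m"
  unfolding outer_prod_def by auto

lemma outer_prod_zero [simp]:
  "u \<in> carrier_vec n \<Longrightarrow> outer_prod u (0\<^sub>v m) = 0\<^sub>m n m"
  "f \<in> carrier_vec m \<Longrightarrow> outer_prod (0\<^sub>v n) f = 0\<^sub>m n m"
  by (auto simp: outer_prod_def)

lemma outer_prod_nonzero:
  fixes u f :: "'a :: semiring_no_zero_divisors vec"
  assumes "u \<in> carrier_vec n" "f \<in> carrier_vec m" "u \<noteq> 0\<^sub>v n" "f \<noteq> 0\<^sub>v m"
  shows "outer_prod u f \<noteq> 0\<^sub>m n m"
proof
  assume *: "outer_prod u f = 0\<^sub>m n m"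
  have dims: "dim_vec u = n" "dim_vec f = m" using assms by auto
  obtain i where i: "i < n" "u $ i \<noteq> 0"
    using assms(3) dims by (metis eq_vecI index_zero_vec)
  obtain j where j: "j < m" "f $ j \<noteq> 0"
    using assms(4) dims by (metis eq_vecI index_zero_vec)
  have "u $ i * f $ j = outer_prod u f $$ (i, j)"
    using i j dims by (simp add: outer_prod_def)
  with * i j show False by simp
qed

lemma mult_outer_prod:
  fixes M :: "'a :: comm_semiring_0 mat"
  assumes "M \<in> carrier_mat n n" "u \<in> carrier_vec n" "f \<in> carrier_vec n"
  shows "M * outer_prod u f = outer_prod (M *\<^sub>v u) f"
  using assms
  by (intro eq_matI) (auto simp: outer_prod_def scalar_prod_def sum_distrib_right mult.assoc)

lemma outer_prod_mult:
  fixes M :: "'a :: comm_semiring_0 mat"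
  assumes "M \<in> carrier_mat n n" "u \<in> carrier_vec n" "f \<in> carrier_vec n"
  shows "outer_prod u f * M = outer_prod u (transpose_mat M *\<^sub>v f)"
  using assms
  by (intro eq_matI)
    (auto simp: outer_prod_def scalar_prod_def sum_distrib_left mult_ac intro!: sum.cong)

lemma outer_prod_mult_outer_prod_zero:
  fixes u f v g :: "'a :: comm_semiring_0 vec"
  assumes "u \<in> carrier_vec n" "f \<in> carrier_vec n" "v \<in> carrier_vec n" "g \<in> carrier_vec n"
    and "f \<bullet> v = 0"
  shows "outer_prod u f * outer_prod v g = 0\<^sub>m n n"
proof -
  have "outer_prod u f *\<^sub>v v = 0\<^sub>v n"
    using assms
    by (intro eq_vecI)
      (auto simp: outer_prod_def scalar_prod_def mult.assoc simp flip: sum_distrib_left)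
  then show ?thesis
    using assms by (subst mult_outer_prod[of _ n]) auto
qed

text \<open>For \<open>u = col A j\<close>, \<open>A * A = 0\<close> gives \<open>A u = 0\<close>.
  With \<open>f\<close> in the left kernel, both products of \<open>A\<close> with the outer product
  vanish; also \<open>f\<close> kills the image of \<open>A\<close>, hence \<open>u\<close>, so the
  outer product squares to zero. The condition on \<open>v\<close> serves to link two such
  matrices.\<close>

lemma square_zero_commuting_outer_prod:
  fixes A :: "'a :: field mat"
  assumes n: "n \<ge> 3" and A: "square_zero n A" and v: "v \<in> carrier_vec n"
    and j: "j < n" "col A j \<noteq> 0\<^sub>v n"
  obtains f where "f \<in> carrier_vec n" "v \<bullet> f = 0" "square_zero n (outer_prod (col A j) f)"
    "A * outer_prod (col A j) f = outer_prod (col A j) f * A"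
proof -
  have cA: "A \<in> carrier_mat n n" "dim_row A = n" "dim_col A = n" and AA: "A * A = 0\<^sub>m n n"
    using A by (auto simp: square_zero_def)
  obtain f where f: "f \<in> carrier_vec n" "f \<noteq> 0\<^sub>v n" "transpose_mat A *\<^sub>v f = 0\<^sub>v n" "v \<bullet> f = 0"
    using square_zero_left_kernel[OF n A v] .
  define u where "u = col A j"
  have u: "u \<in> carrier_vec n" using cA(1) j(1) by (simp add: u_def carrier_vecI)
  have "u \<bullet> f = (transpose_mat A *\<^sub>v f) $ j"
    using j cA by (simp add: u_def)
  then have "u \<bullet> f = 0" using f j by simp
  then have fu: "f \<bullet> u = 0" using f u by (simp add: comm_scalar_prod[of f n])
  have "A *\<^sub>v u = col (A * A) j"
    unfolding u_def by (rule col_mult2[OF cA(1) cA(1) j(1), symmetric])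
  then have Au: "A *\<^sub>v u = 0\<^sub>v n" using AA j by simp
  have "square_zero n (outer_prod u f)"
    unfolding square_zero_def
    using outer_prod_mult_outer_prod_zero[OF u f(1) u f(1) fu] outer_prod_nonzero[OF u f(1)] u f j
    by (auto simp: u_def)
  moreover have "A * outer_prod u f = outer_prod u f * A"
    using mult_outer_prod[OF cA(1) u f(1)] outer_prod_mult[OF cA(1) u f(1)] Au f u by simp
  ultimately show ?thesis using f that unfolding u_def by blast
qed

lemma square_zero_col:
  assumes "square_zero n A"
  obtains j where "j < n" "col A j \<noteq> 0\<^sub>v n"
proof -
  have "\<exists>j<n. col A j \<noteq> 0\<^sub>v n"
  proof (rule ccontr)
    assume "\<not> ?thesis"
    then have "A = 0\<^sub>m n n"
      using assms by (intro mat_col_eqI) (auto simp: square_zero_def)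
    with assms show False by (simp add: square_zero_def)
  qed
  with that show ?thesis by blast
qed

lemma square_zero_connect:
  fixes A B :: "'a :: field mat"
  assumes n: "n \<ge> 3" and A: "square_zero n A" and B: "square_zero n B"
  obtains C D where "square_zero n C" "square_zero n D"
    "A * C = C * A" "C * D = D * C" "D * B = B * D"
proof -
  obtain i where i: "i < n" "col A i \<noteq> 0\<^sub>v n" using square_zero_col[OF A] .
  obtain j where j: "j < n" "col B j \<noteq> 0\<^sub>v n" using square_zero_col[OF B] .
  have u: "col A i \<in> carrier_vec n" and v: "col B j \<in> carrier_vec n"
    using A B by (auto simp: square_zero_def)
  obtain f where f: "f \<in> carrier_vec n" "col B j \<bullet> f = 0"
    "square_zero n (outer_prod (col A i) f)"
    "A * outer_prod (col A i) f = outer_prod (col A i) f * A"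
    using square_zero_commuting_outer_prod[OF n A v i] .
  obtain g where g: "g \<in> carrier_vec n" "col A i \<bullet> g = 0"
    "square_zero n (outer_prod (col B j) g)"
    "B * outer_prod (col B j) g = outer_prod (col B j) g * B"
    using square_zero_commuting_outer_prod[OF n B u j] .
  have "f \<bullet> col B j = 0" "g \<bullet> col A i = 0"
    using f g u v by (simp_all add: comm_scalar_prod[of _ n])
  \<comment> \<open>Both products are zero, since each functional kills the other matrix's
    column.\<close>
  then have "outer_prod (col A i) f * outer_prod (col B j) g
      = outer_prod (col B j) g * outer_prod (col A i) f"
    using f g u v by (simp add: outer_prod_mult_outer_prod_zero)
  then show ?thesis
    using that[OF f(3) g(3) f(4)] g(4) by simp
qed

subsection \<open>The centralizer of a companion matrix in characteristic 2\<close>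

lemma char_2_add_self:
  assumes "CHAR('a :: semiring_1) = 2"
  shows "(x :: 'a) + x = 0"
proof -
  have "(2 :: 'a) = 0"
    using of_nat_CHAR[where 'a = 'a] assms by simp
  then show ?thesis
    by (metis mult_2 mult_zero_left)
qed

text \<open>Off-diagonal terms occur in equal pairs and cancel; this is what makes squaring additive
  below.\<close>

lemma char_2_symmetric_double_sum:
  fixes g :: "nat \<Rightarrow> nat \<Rightarrow> 'a :: field"
  assumes char: "CHAR('a) = 2" and sym: "\<And>i j. g i j = g j i"
  shows "(\<Sum>i<m. \<Sum>j<m. g i j) = (\<Sum>i<m. g i i)"
proof (induction m)
  case (Suc m)
  have "(\<Sum>i<Suc m. \<Sum>j<Suc m. g i j)
      = (\<Sum>i<m. \<Sum>j<m. g i j) + ((\<Sum>i<m. g i m) + (\<Sum>j<m. g m j)) + g m m"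
    by (simp add: sum.distrib algebra_simps)
  also have "(\<Sum>j<m. g m j) = (\<Sum>i<m. g i m)"
    by (rule sum.cong) (auto intro: sym)
  finally show ?case
    using Suc char_2_add_self[OF char] by simp
qed simp

text \<open>\<open>trinomial_coeff m s k\<close> is the coefficient of \<open>x\<^sup>k\<close> in the reduction of \<open>x\<^sup>s\<close> modulo
  \<open>x\<^sup>m + x + 1\<close> in characteristic 2, valid for \<open>s \<le> 2m - 2\<close> and \<open>k < m\<close>; for \<open>m = 1\<close> the
  modulus is \<open>x + 1\<close> instead.\<close>

definition trinomial_coeff :: "nat \<Rightarrow> nat \<Rightarrow> nat \<Rightarrow> 'a :: semiring_1" where
  "trinomial_coeff m s k =
    (if s < m then of_bool (k = s) else of_bool (k = s - m \<or> k = s - m + 1))"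

text \<open>Multiplication by \<open>x\<close> modulo the same polynomial.\<close>

definition companion_entry :: "nat \<Rightarrow> nat \<Rightarrow> nat \<Rightarrow> 'a :: semiring_1" where
  "companion_entry m k j = (if j + 1 < m then of_bool (k = j + 1) else of_bool (k \<le> 1))"

lemma sum_mult_companion:
  fixes x :: "nat \<Rightarrow> 'a :: field"
  assumes "j < m"
  shows "(\<Sum>l<m. x l * companion_entry m l j) =
    (if j + 1 < m then x (j + 1) else x 0 + (if m > 1 then x 1 else 0))"
proof (cases "j + 1 < m")
  case True
  then have "(\<Sum>l<m. x l * companion_entry m l j) = (\<Sum>l<m. if l = j + 1 then x l else 0)"
    by (intro sum.cong) (auto simp: companion_entry_def)
  with True show ?thesis by simp
next
  case False
  then have "(\<Sum>l<m. x l * companion_entry m l j)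
      = (\<Sum>l<m. (if l = 0 then x l else 0) + (if l = 1 then x l else 0))"
    by (intro sum.cong) (auto simp: companion_entry_def)
  with False assms show ?thesis by (simp add: sum.distrib)
qed

lemma sum_companion_mult:
  fixes x :: "nat \<Rightarrow> 'a :: field"
  assumes "k < m"
  shows "(\<Sum>l<m. companion_entry m k l * x l) =
    (if k > 0 then x (k - 1) else 0) + (if k \<le> 1 then x (m - 1) else 0)"
proof -
  have "(\<Sum>l<m. companion_entry m k l * x l)
      = (\<Sum>l<m. (if l = k - 1 then if k > 0 then x l else 0 else 0)
          + (if l = m - 1 then if k \<le> 1 then x l else 0 else 0))"
    using assms by (intro sum.cong) (auto simp: companion_entry_def)
  with assms show ?thesis by (auto simp: sum.distrib)
qed

text \<open>The polynomial \<open>x\<^sup>m + x + 1\<close> is squarefree: the squares \<open>x\<^bsup>2i\<^esup>\<close>, \<open>i < m\<close>, remain linearly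
  independent modulo it.\<close>

lemma trinomial_even_powers_independent:
  fixes c :: "nat \<Rightarrow> 'a :: field"
  assumes zero: "\<And>k. k < m \<Longrightarrow> (\<Sum>l<m. c l * trinomial_coeff m (2 * l) k) = 0"
  assumes i: "i < m"
  shows "c i = 0"
proof -
  have high: "c i = 0" if i: "i < m" "m \<le> 2 * i" for i
  proof -
    \<comment> \<open>The power x^(2i) reduces to x^(2i-m) + x^(2i-m+1), and \<open>k\<close> is the
      odd one of these exponents. Unreduced even powers never reach an odd position, and distinct
      reduced ones have distinct odd exponents, so position \<open>k\<close> isolates
      \<open>c i\<close>.\<close>
    define k where "k = (if even m then 2 * i - m + 1 else 2 * i - m)"
    have k: "k < m" "odd k"
      using that by (auto simp: k_def)
    have "(\<Sum>l<m. c l * trinomial_coeff m (2 * l) k) = (\<Sum>l<m. if l = i then c l else 0)"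
    proof (rule sum.cong)
      fix l assume "l \<in> {..<m}"
      have "k = 2 * l - m \<or> k = 2 * l - m + 1 \<longleftrightarrow> l = i" if "m \<le> 2 * l"
      proof (cases "even m")
        case True
        with that i show ?thesis by (simp add: k_def) presburger
      next
        case False
        with that i show ?thesis by (simp add: k_def) presburger
      qed
      then show "c l * trinomial_coeff m (2 * l) k = (if l = i then c l else 0)"
        using i k by (auto simp: trinomial_coeff_def)
    qed simp
    with i zero[OF k(1)] show ?thesis by simp
  qed
  show ?thesis
  proof (cases "m \<le> 2 * i")
    case True
    with i show ?thesis by (rule high)
  next
    case False
    \<comment> \<open>With the reduced powers gone, the remaining even powers sit at their own
      positions.\<close>
    have "(\<Sum>l<m. c l * trinomial_coeff m (2 * l) (2 * i)) = (\<Sum>l<m. if l = i then c l else 0)"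
      using False high by (intro sum.cong) (auto simp: trinomial_coeff_def)
    with i False zero[of "2 * i"] show ?thesis by simp
  qed
qed

text \<open>Multiplication by x shifts coefficients up, and the overflow x^m returns as x + 1. Under
  the bound on \<open>s\<close>, overflow happens only for \<open>s = m - 1\<close>.\<close>

lemma trinomial_coeff_Suc:
  assumes "k < m" "s + 2 < 2 * m"
  shows "(trinomial_coeff m (Suc s) k :: 'a :: semiring_1) =
    (if k > 0 then trinomial_coeff m s (k - 1) else 0)
      + (if k \<le> 1 then trinomial_coeff m s (m - 1) else 0)"
proof -
  consider "s + 1 < m" | "s + 1 = m" | "m \<le> s" by linarith
  then show ?thesis
  proof cases
    case 1
    then show ?thesis by (auto simp: trinomial_coeff_def)
  next
    case 2
    then show ?thesis using assms by (auto simp: trinomial_coeff_def)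
  next
    case 3
    then have "trinomial_coeff m s (m - 1) = (0 :: 'a)"
      using assms by (auto simp: trinomial_coeff_def)
    moreover have "k = Suc s - m \<or> k = Suc s - m + 1
        \<longleftrightarrow> k > 0 \<and> (k - 1 = s - m \<or> k - 1 = s - m + 1)"
      using 3 by linarith
    ultimately show ?thesis
      using 3 by (simp add: trinomial_coeff_def del: One_nat_def)
  qed
qed

text \<open>A matrix commuting with the companion matrix is a polynomial q in it. In characteristic
  2, q^2 is the sum of q_i^2 x^(2i), so \<open>Q\<close> squaring to zero forces every q_i^2 to
  vanish by independence of the even powers.\<close>

lemma companion_commutant_reduced:
  fixes Q :: "nat \<Rightarrow> nat \<Rightarrow> 'a :: field"
  assumes char: "CHAR('a) = 2"
    and comm: "\<And>k j. k < m \<Longrightarrow> j < m \<Longrightarrow>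
      (\<Sum>l<m. Q k l * companion_entry m l j) = (\<Sum>l<m. companion_entry m k l * Q l j)"
    and sq: "\<And>k j. k < m \<Longrightarrow> j < m \<Longrightarrow> (\<Sum>l<m. Q k l * Q l j) = 0"
    and "k < m" "j < m"
  shows "Q k j = 0"
proof -
  \<comment> \<open>\<open>Q\<close> is the polynomial in the companion matrix whose coefficients form its first column.\<close>
  have coeff: "Q k j = (\<Sum>i<m. Q i 0 * trinomial_coeff m (i + j) k)" if "k < m" "j < m" for k j
    using that
  proof (induction j arbitrary: k)
    case 0
    then have "(\<Sum>i<m. Q i 0 * trinomial_coeff m (i + 0) k) = (\<Sum>i<m. if i = k then Q i 0 else 0)"
      by (intro sum.cong) (auto simp: trinomial_coeff_def)
    with 0 show ?case by simp
  next
    case (Suc j)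
    let ?t = "trinomial_coeff m :: nat \<Rightarrow> nat \<Rightarrow> 'a"
    \<comment> \<open>The companion matrix sends basis vector \<open>j\<close> to basis vector
      \<open>j + 1\<close>, so commutation makes column \<open>j + 1\<close> of \<open>Q\<close> the
      companion matrix times column \<open>j\<close>.\<close>
    have "Q k (Suc j) = (\<Sum>l<m. Q k l * companion_entry m l j)"
      using Suc.prems by (simp add: sum_mult_companion)
    also have "\<dots> = (if k > 0 then Q (k - 1) j else 0) + (if k \<le> 1 then Q (m - 1) j else 0)"
      using Suc.prems by (simp add: comm sum_companion_mult)
    also have "\<dots> = (\<Sum>i<m. Q i 0 * ((if k > 0 then ?t (i + j) (k - 1) else 0)
        + (if k \<le> 1 then ?t (i + j) (m - 1) else 0)))"
      using Suc.prems Suc.IH[of "k - 1"] Suc.IH[of "m - 1"]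
      by (auto simp: distrib_left sum.distrib)
    also have "\<dots> = (\<Sum>i<m. Q i 0 * ?t (i + Suc j) k)"
    proof (rule sum.cong)
      fix i assume "i \<in> {..<m}"
      then have "?t (i + Suc j) k = (if k > 0 then ?t (i + j) (k - 1) else 0)
          + (if k \<le> 1 then ?t (i + j) (m - 1) else 0)"
        using trinomial_coeff_Suc[of k m "i + j"] Suc.prems by simp
      then show "Q i 0 * ((if k > 0 then ?t (i + j) (k - 1) else 0)
          + (if k \<le> 1 then ?t (i + j) (m - 1) else 0)) = Q i 0 * ?t (i + Suc j) k"
        by (simp only:)
    qed simp
    finally show ?case .
  qed
  have "(\<Sum>i<m. (Q i 0)\<^sup>2 * trinomial_coeff m (2 * i) k) = 0" if k: "k < m" for k
  proof -
    \<comment> \<open>The first column of the square of \<open>Q\<close> holds the coefficients of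
      q^2.\<close>
    have "0 = (\<Sum>l<m. Q k l * Q l 0)"
      using sq[of k 0] k by simp
    also have "\<dots> = (\<Sum>l<m. \<Sum>i<m. Q i 0 * Q l 0 * trinomial_coeff m (i + l) k)"
      using coeff[OF k] by (intro sum.cong) (auto simp: sum_distrib_left mult_ac)
    also have "\<dots> = (\<Sum>l<m. Q l 0 * Q l 0 * trinomial_coeff m (l + l) k)"
      by (rule char_2_symmetric_double_sum[OF char]) (simp add: mult_ac add.commute)
    finally show ?thesis by (simp add: power2_eq_square mult_2)
  qed
  then have "(Q i 0)\<^sup>2 = 0" if "i < m" for i
    using that by (rule trinomial_even_powers_independent)
  with assms(4,5) coeff[of k j] show ?thesis by simp
qed

subsection \<open>Square-zero matrices without a common square-zero centralizer\<close>

lemma mat_mult_entry: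
  assumes "A \<in> carrier_mat n n" "B \<in> carrier_mat n n" "i < n" "j < n"
  shows "(A * B) $$ (i, j) = (\<Sum>l<n. A $$ (i, l) * B $$ (l, j))"
  using assms by (simp add: scalar_prod_def lessThan_atLeast0)

lemma square_zero_pair_without_common_neighbour:
  assumes char: "CHAR('a :: field) = 2" and n: "n \<ge> 2"
  obtains A B :: "'a :: field mat" where "square_zero n A" "square_zero n B"
    "\<And>C. square_zero n C \<Longrightarrow> A * C = C * A \<Longrightarrow> B * C \<noteq> C * B"
proof -
  define m where "m = n div 2"
  have m: "m > 0" "2 * m \<le> n" "n \<le> 2 * m + 1"
    using n by (auto simp: m_def)
  define N :: "nat \<Rightarrow> nat \<Rightarrow> 'a" where "N = companion_entry m"
  define A :: "'a mat" where "A = mat n n (\<lambda>(i, j). if i < m \<and> j = m + i then 1 else 0)"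
  define B :: "'a mat" where
    "B = mat n n (\<lambda>(i, j). if m \<le> i \<and> i < 2 * m \<and> j < m then N (i - m) j else 0)"
  have cA: "A \<in> carrier_mat n n" and cB: "B \<in> carrier_mat n n"
    by (auto simp: A_def B_def)
  have A_left: "(A * C) $$ (i, j) = (if i < m then C $$ (m + i, j) else 0)"
    if "C \<in> carrier_mat n n" "i < n" "j < n" for C i j
  proof -
    have "(A * C) $$ (i, j) = (\<Sum>l<n. if l = m + i then if i < m then C $$ (l, j) else 0 else 0)"
      unfolding mat_mult_entry[OF cA that] using that
      by (intro sum.cong) (auto simp: A_def)
    then show ?thesis using m by auto
  qed
  have A_right: "(C * A) $$ (i, j) = (if m \<le> j \<and> j < 2 * m then C $$ (i, j - m) else 0)"
    if "C \<in> carrier_mat n n" "i < n" "j < n" for C i j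
  proof -
    have "(C * A) $$ (i, j)
        = (\<Sum>l<n. if l = j - m then if m \<le> j \<and> j < 2 * m then C $$ (i, l) else 0 else 0)"
      unfolding mat_mult_entry[OF that(1) cA that(2,3)] using that
      by (intro sum.cong) (auto simp: A_def)
    then show ?thesis using m that by auto
  qed
  have B_left: "(B * C) $$ (i, j)
      = (if m \<le> i \<and> i < 2 * m then \<Sum>l<m. N (i - m) l * C $$ (l, j) else 0)"
    if "C \<in> carrier_mat n n" "i < n" "j < n" for C i j
  proof -
    have "(B * C) $$ (i, j) = (\<Sum>l<n. if l \<in> {..<m}
        then if m \<le> i \<and> i < 2 * m then N (i - m) l * C $$ (l, j) else 0 else 0)"
      unfolding mat_mult_entry[OF cB that] using that
      by (intro sum.cong) (auto simp: B_def)
    also have "\<dots> = (\<Sum>l\<in>{..<n} \<inter> {..<m}.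
        if m \<le> i \<and> i < 2 * m then N (i - m) l * C $$ (l, j) else 0)"
      by (rule sum.inter_restrict[symmetric]) simp
    also have "{..<n} \<inter> {..<m} = {..<m}" using m by auto
    finally show ?thesis by auto
  qed
  have B_right: "(C * B) $$ (i, j) = (if j < m then \<Sum>l<m. C $$ (i, m + l) * N l j else 0)"
    if "C \<in> carrier_mat n n" "i < n" "j < n" for C i j
  proof -
    have "(C * B) $$ (i, j) = (\<Sum>l<n. if l \<in> {m..<2 * m}
        then if j < m then C $$ (i, l) * N (l - m) j else 0 else 0)"
      unfolding mat_mult_entry[OF that(1) cB that(2,3)] using that
      by (intro sum.cong) (auto simp: B_def)
    also have "\<dots> = (\<Sum>l\<in>{..<n} \<inter> {m..<2 * m}.
        if j < m then C $$ (i, l) * N (l - m) j else 0)"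
      by (rule sum.inter_restrict[symmetric]) simp
    also have "{..<n} \<inter> {m..<2 * m} = {m..<2 * m}" using m by auto
    also have "(\<Sum>l\<in>{m..<2 * m}. if j < m then C $$ (i, l) * N (l - m) j else 0)
        = (\<Sum>l<m. if j < m then C $$ (i, m + l) * N l j else 0)"
      by (rule sum.reindex_bij_witness[of _ "\<lambda>l. m + l" "\<lambda>l. l - m"]) auto
    finally show ?thesis by simp
  qed
  have "A * A = 0\<^sub>m n n"
    using cA m by (intro eq_matI)
      (auto simp: A_left[OF cA] simp del: index_mult_mat(1), auto simp: A_def)
  moreover have "A $$ (0, m) = 1"
    using m by (simp add: A_def)
  then have "A \<noteq> 0\<^sub>m n n"
    using m by auto
  ultimately have sA: "square_zero n A"
    using cA by (simp add: square_zero_def)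
  have "B * B = 0\<^sub>m n n"
    using cB m by (intro eq_matI)
      (auto simp: B_left[OF cB] simp del: index_mult_mat(1), auto simp: B_def)
  moreover have "N 0 (m - 1) = 1"
    using m by (simp add: N_def companion_entry_def)
  then have "B $$ (m, m - 1) = 1"
    using m by (simp add: B_def)
  then have "B \<noteq> 0\<^sub>m n n"
    using m by auto
  ultimately have sB: "square_zero n B"
    using cB by (simp add: square_zero_def)
  have "C = 0\<^sub>m n n"
    if cC: "C \<in> carrier_mat n n" and CC: "C * C = 0\<^sub>m n n"
      and AC: "A * C = C * A" and BC: "B * C = C * B" for C
  proof -
    have eA: "(if i < m then C $$ (m + i, j) else 0)
        = (if m \<le> j \<and> j < 2 * m then C $$ (i, j - m) else 0)" if "i < n" "j < n" for i j
      using A_left[OF cC that] A_right[OF cC that] AC by simp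
    have eB: "(if m \<le> i \<and> i < 2 * m then \<Sum>l<m. N (i - m) l * C $$ (l, j) else 0)
        = (if j < m then \<Sum>l<m. C $$ (i, m + l) * N l j else 0)" if "i < n" "j < n" for i j
      using B_left[OF cC that] B_right[OF cC that] BC by simp
    \<comment> \<open>Here and in \<open>N_inj_left\<close>: \<open>N\<close> is invertible because
      its modulus has constant term 1.\<close>
    have N_inj_right: "x l = 0"
      if x: "\<And>j. j < m \<Longrightarrow> (\<Sum>l<m. x l * N l j) = 0" and l: "l < m" for x :: "nat \<Rightarrow> 'a" and l
    proof -
      have pos: "x l = 0" if "l > 0" "l < m" for l
        using x[of "l - 1"] that by (simp add: N_def sum_mult_companion)
      then show ?thesis
        using x[of "m - 1"] m l
        by (cases "l = 0") (auto simp: N_def sum_mult_companion split: if_splits)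
    qed
    have N_inj_left: "x l = 0"
      if x: "\<And>k. k < m \<Longrightarrow> (\<Sum>l<m. N k l * x l) = 0" and l: "l < m" for x :: "nat \<Rightarrow> 'a" and l
    proof -
      have last: "x (m - 1) = 0"
        using x[of 0] m by (simp add: N_def sum_companion_mult)
      show ?thesis
      proof (cases "Suc l < m")
        case True
        then show ?thesis
          using x[OF True] unfolding N_def sum_companion_mult[OF True] last by simp
      next
        case False
        with l have "l = m - 1" by simp
        with last show ?thesis by simp
      qed
    qed
    \<comment> \<open>The facts \<open>cPQ\<close> treat \<open>C\<close> as a 3 by 3 block matrix
      with block sizes m, m and n - 2m, the last being 0 or 1. Commutation with \<open>A\<close>
      yields the blocks 21, 22, 23 and 31; commutation with \<open>B\<close> and invertibility of
      \<open>N\<close> yield 12, 32 and 13.\<close>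
    have c21: "C $$ (m + i, j) = 0" if "i < m" "j < m" for i j
      using eA[of i j] that m by simp
    have c22: "C $$ (m + i, m + j) = C $$ (i, j)" if "i < m" "j < m" for i j
      using eA[of i "m + j"] that m by simp
    have c23: "C $$ (m + i, 2 * m) = 0" if "i < m" "2 * m < n" for i
      using eA[of i "2 * m"] that m by simp
    have c31: "C $$ (2 * m, j) = 0" if "j < m" "2 * m < n" for j
      using eA[of "2 * m" "m + j"] that m by simp
    have c12: "C $$ (i, m + l) = 0" if "i < m" "l < m" for i l
    proof (rule N_inj_right[where x = "\<lambda>l. C $$ (i, m + l)", OF _ that(2)])
      fix j assume "j < m"
      with eB[of i j] that m show "(\<Sum>l<m. C $$ (i, m + l) * N l j) = 0" by simp
    qed
    have c32: "C $$ (2 * m, m + l) = 0" if "l < m" "2 * m < n" for l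
    proof (rule N_inj_right[where x = "\<lambda>l. C $$ (2 * m, m + l)", OF _ that(1)])
      fix j assume "j < m"
      with eB[of "2 * m" j] that m show "(\<Sum>l<m. C $$ (2 * m, m + l) * N l j) = 0" by simp
    qed
    have c13: "C $$ (l, 2 * m) = 0" if "l < m" "2 * m < n" for l
    proof (rule N_inj_left[where x = "\<lambda>l. C $$ (l, 2 * m)", OF _ that(1)])
      fix k assume "k < m"
      with eB[of "m + k" "2 * m"] that m show "(\<Sum>l<m. N k l * C $$ (l, 2 * m)) = 0" by simp
    qed
    have comm: "(\<Sum>l<m. C $$ (k, l) * N l j) = (\<Sum>l<m. N k l * C $$ (l, j))"
      if "k < m" "j < m" for k j
      using eB[of "m + k" j] that m c22[of k] by simp
    have C_sq: "(\<Sum>l<n. C $$ (i, l) * C $$ (l, j)) = 0" if "i < n" "j < n" for i j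
      using mat_mult_entry[OF cC cC that] CC that by simp
    have sq: "(\<Sum>l<m. C $$ (k, l) * C $$ (l, j)) = 0" if "k < m" "j < m" for k j
    proof -
      \<comment> \<open>Blocks 21 and 31 vanish, so the upper left block of \<open>C * C\<close> is
        the square of block 11.\<close>
      have "C $$ (k, l) * C $$ (l, j) = 0" if "l \<in> {..<n} - {..<m}" for l
      proof -
        have "l - m < m \<or> l = 2 * m" "l \<ge> m" "l < n" using that m by auto
        then show ?thesis
          using c21[of "l - m" j] c31[of j] \<open>j < m\<close> by auto
      qed
      then have "(\<Sum>l<m. C $$ (k, l) * C $$ (l, j)) = (\<Sum>l<n. C $$ (k, l) * C $$ (l, j))"
        using m by (intro sum.mono_neutral_left) auto
      then show ?thesis using C_sq that m by simp
    qed
    have c11: "C $$ (k, j) = 0" if "k < m" "j < m" for k j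
      using companion_commutant_reduced[where Q = "\<lambda>k j. C $$ (k, j)", OF char _ sq that]
        comm by (simp add: N_def)
    have c33: "C $$ (2 * m, 2 * m) = 0" if "2 * m < n"
    proof -
      \<comment> \<open>Only the diagonal entry of the last row can survive, so its square is an
        entry of \<open>C * C\<close>.\<close>
      have "C $$ (2 * m, l) = 0" if "l < 2 * m" for l
        using c31[of l] c32[of "l - m"] that \<open>2 * m < n\<close> by (cases "l < m") auto
      then have "(\<Sum>l<n. C $$ (2 * m, l) * C $$ (l, 2 * m))
          = (\<Sum>l<n. if l = 2 * m then C $$ (2 * m, 2 * m) * C $$ (2 * m, 2 * m) else 0)"
        using m by (intro sum.cong) auto
      with C_sq[of "2 * m" "2 * m"] that show ?thesis by simp
    qed
    have block: "l < m \<or> (\<exists>l'<m. l = m + l') \<or> l = 2 * m" if "l < n" for l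
    proof -
      from that m have "l < m \<or> (l - m < m \<and> l = m + (l - m)) \<or> l = 2 * m" by linarith
      then show ?thesis by blast
    qed
    have "C $$ (i, j) = 0" if "i < n" "j < n" for i j
      using block[OF that(1)] block[OF that(2)] that c11 c12 c13 c21 c22 c23 c31 c32 c33 by auto
    then show ?thesis
      using cC by (intro eq_matI) auto
  qed
  then show ?thesis
    using sA sB that unfolding square_zero_def by metis
qed

subsection \<open>Involutions in characteristic 2\<close>

lemma (in group) ord_eq_2_iff:
  assumes "x \<in> carrier G"
  shows "ord x = 2 \<longleftrightarrow> x \<otimes> x = \<one> \<and> x \<noteq> \<one>"
proof
  assume "ord x = 2"
  then show "x \<otimes> x = \<one> \<and> x \<noteq> \<one>"
    using pow_ord_eq_1[OF assms] assms by (auto simp: numeral_2_eq_2)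
next
  assume *: "x \<otimes> x = \<one> \<and> x \<noteq> \<one>"
  then have "x [^] (2 :: nat) = \<one>"
    using assms by (simp add: numeral_2_eq_2)
  then have "ord x dvd 2"
    using assms pow_eq_id by blast
  moreover have "ord x \<noteq> 1"
    using * ord_eq_1[OF assms] by blast
  ultimately show "ord x = 2"
    using prime_nat_iff[of 2] two_is_prime_nat by blast
qed

lemma GL_simps [simp]:
  "\<one>\<^bsub>GL TYPE('a :: field) n\<^esub> = 1\<^sub>m n"
  "x \<otimes>\<^bsub>GL TYPE('a) n\<^esub> y = x * y"
  by (simp_all add: GL_def units_of_def ring_mat_def)

lemma involutions_GL_iff:
  "x \<in> involutions (GL TYPE('a :: field) n)
    \<longleftrightarrow> x \<in> carrier_mat n n \<and> x * x = 1\<^sub>m n \<and> x \<noteq> 1\<^sub>m n"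
proof -
  interpret group "GL TYPE('a) n" by (rule group_GL)
  have "x \<in> carrier (GL TYPE('a) n)" if "x \<in> carrier_mat n n" "x * x = 1\<^sub>m n"
    using that by (auto simp: GL_def units_of_def Units_def ring_mat_def)
  moreover have "x \<in> carrier_mat n n" if "x \<in> carrier (GL TYPE('a) n)"
    using that by (auto simp: GL_def units_of_def Units_def ring_mat_def)
  ultimately show ?thesis
    by (auto simp: involutions_def ord_eq_2_iff)
qed

context
  assumes char: "CHAR('a :: field) = 2"
begin

lemma char_2_mat_add_self:
  assumes "A \<in> carrier_mat n m"
  shows "A + A = (0\<^sub>m n m :: 'a mat)"
  using assms by (intro eq_matI) (auto simp: char_2_add_self[OF char])

lemma add_one_mult_add_one:
  assumes "A \<in> carrier_mat n n" "B \<in> carrier_mat n n"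
  shows "(A + 1\<^sub>m n) * (B + 1\<^sub>m n) = A * B + (A + B + 1\<^sub>m n :: 'a mat)"
proof -
  have "(A + 1\<^sub>m n) * (B + 1\<^sub>m n) = (A * B + B) + (A + 1\<^sub>m n)"
    using assms by (simp add: add_mult_distrib_mat[of _ n n] mult_add_distrib_mat[of _ n n])
  also have "\<dots> = A * B + (A + B + 1\<^sub>m n)"
    using assms by (intro eq_matI) (auto simp: add_ac simp del: index_mult_mat(1))
  finally show ?thesis .
qed

text \<open>The two products differ from \<open>A * B\<close> and \<open>B * A\<close> by the same
  summand, which cancels when added once more.\<close>

lemma add_one_commute_iff:
  assumes A: "A \<in> carrier_mat n n" and B: "B \<in> carrier_mat n n"
  shows "(A + 1\<^sub>m n) * (B + 1\<^sub>m n) = (B + 1\<^sub>m n) * (A + 1\<^sub>m n) \<longleftrightarrow> A * B = (B * A :: 'a mat)"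
proof -
  have "A + B = B + A"
    using A B by (rule comm_add_mat)
  then have "(B + 1\<^sub>m n) * (A + 1\<^sub>m n) = B * A + (A + B + 1\<^sub>m n)"
    using add_one_mult_add_one[OF B A] by simp
  moreover have "X + Z = Y + Z \<longleftrightarrow> X = Y"
    if "X \<in> carrier_mat n n" "Y \<in> carrier_mat n n" "Z \<in> carrier_mat n n" for X Y Z :: "'a mat"
    using that by (metis add_carrier_mat assoc_add_mat char_2_mat_add_self right_add_zero_mat)
  ultimately show ?thesis
    using add_one_mult_add_one[OF A B] A B by simp
qed

text \<open>In characteristic 2 the square of \<open>A + 1\<close> is \<open>A * A + 1\<close>, and
  adding the identity is a self-inverse map.\<close>

lemma involutions_GL_eq:
  "involutions (GL TYPE('a) n) = (\<lambda>A. A + 1\<^sub>m n) ` {A. square_zero n A}"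
proof -
  have twice: "(A + 1\<^sub>m n) + 1\<^sub>m n = A" if "A \<in> carrier_mat n n" for A :: "'a mat"
    using that char_2_mat_add_self[of "1\<^sub>m n" n n]
    by (subst assoc_add_mat[of _ n n]) auto
  have iff: "A + 1\<^sub>m n \<in> involutions (GL TYPE('a) n) \<longleftrightarrow> square_zero n A"
    if A: "A \<in> carrier_mat n n" for A
  proof -
    have "(A + 1\<^sub>m n) * (A + 1\<^sub>m n) = A * A + 1\<^sub>m n"
      using add_one_mult_add_one[OF A A] char_2_mat_add_self[OF A] by simp
    moreover have "A * A + 1\<^sub>m n = 1\<^sub>m n \<longleftrightarrow> A * A = 0\<^sub>m n n"
      using twice[of "A * A"] A char_2_mat_add_self[of "1\<^sub>m n" n n] by auto
    moreover have "A + 1\<^sub>m n = 1\<^sub>m n \<longleftrightarrow> A = 0\<^sub>m n n"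
      using twice[OF A] char_2_mat_add_self[of "1\<^sub>m n" n n]
      by (metis left_add_zero_mat one_carrier_mat)
    ultimately show ?thesis
      using A by (simp add: involutions_GL_iff square_zero_def)
  qed
  show ?thesis
  proof (intro equalityI subsetI)
    fix x assume x: "x \<in> involutions (GL TYPE('a) n)"
    then have c: "x \<in> carrier_mat n n" by (simp add: involutions_GL_iff)
    then have "square_zero n (x + 1\<^sub>m n)"
      using iff[of "x + 1\<^sub>m n"] twice[OF c] x by simp
    then show "x \<in> (\<lambda>A. A + 1\<^sub>m n) ` {A. square_zero n A}"
      using twice[OF c] by (intro image_eqI[of _ _ "x + 1\<^sub>m n"]) auto
  next
    fix x :: "'a mat" assume "x \<in> (\<lambda>A. A + 1\<^sub>m n) ` {A. square_zero n A}"
    then show "x \<in> involutions (GL TYPE('a) n)"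
      using iff by (auto simp: square_zero_def)
  qed
qed

end

subsection \<open>Walks in commuting graphs\<close>

lemma commuting_graph_sel [simp]:
  "pverts (commuting_graph G X) = X"
  "(x, y) \<in> parcs (commuting_graph G X)
    \<longleftrightarrow> x \<in> X \<and> y \<in> X \<and> x \<noteq> y \<and> x \<otimes>\<^bsub>G\<^esub> y = y \<otimes>\<^bsub>G\<^esub> x"
  by (auto simp: commuting_graph_def)

lemma wf_digraph_commuting_graph: "wf_digraph (with_proj (commuting_graph G X))"
  by (rule sym_digraph.axioms(1)[OF sym_digraph_commuting_graph])

text \<open>Repeated vertices are allowed in the commuting sequence; the corresponding steps are dropped
  from the walk.\<close>

lemma commuting_graph_walk:
  assumes "x \<in> X" "c \<in> X" "d \<in> X" "y \<in> X"
    and "x \<otimes>\<^bsub>G\<^esub> c = c \<otimes>\<^bsub>G\<^esub> x" "c \<otimes>\<^bsub>G\<^esub> d = d \<otimes>\<^bsub>G\<^esub> c" "d \<otimes>\<^bsub>G\<^esub> y = y \<otimes>\<^bsub>G\<^esub> d"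
  obtains p where "pre_digraph.awalk (commuting_graph G X) x p y" "length p \<le> 3"
proof -
  interpret wf_digraph "with_proj (commuting_graph G X)"
    by (rule wf_digraph_commuting_graph)
  define p where "p = filter (\<lambda>(a, b). a \<noteq> b) [(x, c), (c, d), (d, y)]"
  have "awalk x p y"
    using assms by (auto simp: p_def awalk_simps)
  moreover have "length p \<le> 3"
    by (simp add: p_def)
  ultimately show ?thesis by (rule that)
qed

lemma (in wf_digraph) awalk_cost_unit: "awalk_cost (\<lambda>_. 1) p = length p"
  by (induction p) auto

lemma graph_dist_commuting_graph_le:
  assumes "pre_digraph.awalk (commuting_graph G X) x p y" "length p \<le> k"
  shows "graph_dist (commuting_graph G X) x y \<le> k"
proof -
  interpret wf_digraph "with_proj (commuting_graph G X)"
    by (rule wf_digraph_commuting_graph)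
  have "graph_dist (commuting_graph G X) x y \<le> ereal (length p)"
    unfolding graph_dist_def using min_cost_le_walk_cost[OF assms(1), of "\<lambda>_. 1"]
    by (simp add: awalk_cost_unit)
  also have "\<dots> \<le> k" using assms(2) by simp
  finally show ?thesis .
qed

text \<open>A walk with at most two arcs yields a vertex commuting with both ends: \<open>x\<close>
  itself for length 0 or 1, the middle vertex for length 2.\<close>

lemma graph_dist_commuting_graph_ge_3:
  assumes "x \<in> X" "y \<in> X"
    and no: "\<And>z. z \<in> X \<Longrightarrow> x \<otimes>\<^bsub>G\<^esub> z = z \<otimes>\<^bsub>G\<^esub> x \<Longrightarrow> y \<otimes>\<^bsub>G\<^esub> z \<noteq> z \<otimes>\<^bsub>G\<^esub> y"
  shows "graph_dist (commuting_graph G X) x y \<ge> 3"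
proof -
  interpret wf_digraph "with_proj (commuting_graph G X)"
    by (rule wf_digraph_commuting_graph)
  have "3 \<le> length p" if p: "awalk x p y" for p
  proof (rule ccontr)
    assume "\<not> 3 \<le> length p"
    then consider "p = []" | e where "p = [e]" | e f where "p = [e, f]"
      by (cases p; cases "tl p"; cases "tl (tl p)") auto
    then show False
    proof cases
      case 1
      with p no[of x] assms show False by (simp add: awalk_simps)
    next
      case 2
      with p no[of x] assms show False by (cases e) (auto simp: awalk_simps)
    next
      case 3
      with p no[of "snd e"] show False by (cases e; cases f) (auto simp: awalk_simps)
    qed
  qed
  then show ?thesis
    unfolding graph_dist_def \<mu>_def by (auto intro!: INF_greatest simp: awalk_cost_unit)
qed

lemma connected_commuting_graphI:
  assumes "X \<noteq> {}"
    and "\<And>x y. x \<in> X \<Longrightarrow> y \<in> X \<Longrightarrow> \<exists>p. pre_digraph.awalk (commuting_graph G X) x p y"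
  shows "Digraph_Component.connected (commuting_graph G X)"
proof -
  interpret wf_digraph "with_proj (commuting_graph G X)"
    by (rule wf_digraph_commuting_graph)
  have sym: "symmetric (commuting_graph G X)"
    using sym_digraph_commuting_graph by (rule sym_digraph.sym_arcs)
  show ?thesis
    unfolding connected_def
    using assms by (intro strongly_connectedI)
      (auto simp: reachable_mk_symmetric_eq[OF sym] reachable_awalk)
qed

section \<open>Connectedness and the exact diameter\<close>

theorem corollary1p3:
  fixes n :: nat and X :: "'a :: field mat set"
  assumes "CHAR('a) = 2"
    and "n \<ge> 3"
    and "X = involutions (GL TYPE('a) n)"
  shows "Digraph_Component.connected (commuting_graph (GL TYPE('a) n) X) \<and>
    graph_diameter (commuting_graph (GL TYPE('a) n) X) = 3"
proof
  let ?G = "GL TYPE('a) n"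
  have X: "X = (\<lambda>A. A + 1\<^sub>m n) ` {A. square_zero n A}"
    using assms(1,3) by (simp add: involutions_GL_eq)
  have comm: "(A + 1\<^sub>m n) * (B + 1\<^sub>m n) = (B + 1\<^sub>m n) * (A + 1\<^sub>m n) \<longleftrightarrow> A * B = B * A"
    if "square_zero n A" "square_zero n B" for A B :: "'a mat"
    using that assms(1) by (intro add_one_commute_iff) (auto simp: square_zero_def)
  have walk: "\<exists>p. pre_digraph.awalk (commuting_graph ?G X) x p y \<and> length p \<le> 3"
    if xy: "x \<in> X" "y \<in> X" for x y
  proof -
    obtain A B where AB: "square_zero n A" "x = A + 1\<^sub>m n" "square_zero n B" "y = B + 1\<^sub>m n"
      using xy unfolding X by auto
    obtain C D where CD: "square_zero n C" "square_zero n D"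
        "A * C = C * A" "C * D = D * C" "D * B = B * D"
      using square_zero_connect[OF assms(2) AB(1,3)] .
    show ?thesis
    proof (rule commuting_graph_walk[of x X "C + 1\<^sub>m n" "D + 1\<^sub>m n" y ?G])
      show "C + 1\<^sub>m n \<in> X" "D + 1\<^sub>m n \<in> X"
        using CD X by auto
    qed (use xy AB CD comm in auto)
  qed
  \<comment> \<open>This pair attains the diameter and also shows that \<open>X\<close> is nonempty,
    as connectedness requires.\<close>
  obtain A B :: "'a mat" where AB: "square_zero n A" "square_zero n B"
      and no: "\<And>C. square_zero n C \<Longrightarrow> A * C = C * A \<Longrightarrow> B * C \<noteq> C * B"
    using square_zero_pair_without_common_neighbour[OF assms(1)] assms(2)
    by (metis Suc_1 Suc_leD eval_nat_numeral(3))
  have AB_X: "A + 1\<^sub>m n \<in> X" "B + 1\<^sub>m n \<in> X"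
    using AB X by auto
  show "Digraph_Component.connected (commuting_graph ?G X)"
    using AB_X walk by (intro connected_commuting_graphI) blast+
  have "graph_dist (commuting_graph ?G X) x y \<le> 3" if "x \<in> X" "y \<in> X" for x y
    using walk[OF that] graph_dist_commuting_graph_le[of ?G X x _ y 3] by auto
  moreover have "3 \<le> graph_dist (commuting_graph ?G X) (A + 1\<^sub>m n) (B + 1\<^sub>m n)"
  proof (rule graph_dist_commuting_graph_ge_3[OF AB_X])
    fix z assume "z \<in> X" "(A + 1\<^sub>m n) \<otimes>\<^bsub>?G\<^esub> z = z \<otimes>\<^bsub>?G\<^esub> (A + 1\<^sub>m n)"
    then obtain C where "square_zero n C" "z = C + 1\<^sub>m n" "A * C = C * A"
      using X comm[OF AB(1)] by auto
    then show "(B + 1\<^sub>m n) \<otimes>\<^bsub>?G\<^esub> z \<noteq> z \<otimes>\<^bsub>?G\<^esub> (B + 1\<^sub>m n)"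
      using no comm[OF AB(2)] by simp
  qed
  ultimately show "graph_diameter (commuting_graph ?G X) = 3"
    unfolding graph_diameter_def using AB_X
    by (intro antisym SUP_least SUP_upper2[of "(A + 1\<^sub>m n, B + 1\<^sub>m n)"]) auto
qed

end
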